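(* Let $t$ be a positive integer, $c=(c_0,\ldots,c_{t-1})\in\mathbb Z^t$ with $\sum_j c_j=0$, and $(\lambda^0,\ldots,\lambda^{t-1})$ a $t$-tuple of partitions. For $0\le j\le t-1$ write $\mathcal L_j=L^+(\lambda^j)$, $\mathcal A_j=A^+(\lambda^j)$, $\mathfrak A_j^-=\mathbb N\setminus\mathcal L_j$, $\mathfrak L_j^-=\mathbb N\setminus\mathcal A_j$, and define: (i) if $c_j\ge0$: $L_j=\{(l-c_j)t+t-j-1: l\in\mathcal L_j,\ l\ge c_j\}$ and $A_j=\{(a+c_j)t+j: a\in\mathcal A_j\}\cup\{(c_j-a-1)t+j: a\in\mathfrak A_j^-,\ a<c_j\}$; (ii) if $c_j\le0$: $L_j=\{(l+|c_j|)t+t-j-1: l\in\mathcal L_j\}\cup\{(|c_j|-l-1)t+t-j-1: l\in\mathfrak L_j^-,\ l<|c_j|\}$ and $A_j=\{(a-|c_j|)t+j: a\in\mathcal A_j,\ a\ge|c_j|\}$. Let $\mathcal L=\bigcup_j L_j$ and $\mathcal A=\bigcup_j A_j$. Then there is a partition $\lambda$ with Frobenius symbol $(\mathcal L\mid\mathcal A)$ (i.e. $L^+(\lambda)=\mathcal L$, $A^+(\lambda)=\mathcal A$), and $\lambda$ has characteristic vector $c_t(\lambda)=c$ and $t$-quotient $(\lambda^0,\ldots,\lambda^{t-1})$.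
   Context: $\mathbb N=\{0,1,2,\ldots\}$. For a partition $\lambda$ with Durfee number $s=\#\{i:\lambda_i\ge i\}$ and conjugate $\lambda^*$: arm set $A^+(\lambda)=\{\lambda_i-i:1\le i\le s\}$, leg set $L^+(\lambda)=\{\lambda^*_i-i:1\le i\le s\}$; Frobenius symbol $(L^+(\lambda)\mid A^+(\lambda))$; any two finite subsets of $\mathbb N$ of equal cardinality are the leg and arm sets of a unique partition. For $t\ge1$ and $0\le j\le t-1$ put $\widetilde A_j^+(\lambda)=\{q\in\mathbb N: qt+j\in A^+(\lambda)\}$, $\widetilde L_j^+(\lambda)=\{q\in\mathbb N: qt+t-j-1\in L^+(\lambda)\}$, $c_j=|\widetilde A_j^+(\lambda)|-|\widetilde L_j^+(\lambda)|$; $c_t(\lambda)=(c_0,\ldots,c_{t-1})$ is the characteristic vector. With $S_j=\widetilde A_j^+(\lambda)\cup\{-q-1:q\in\mathbb N\setminus\widetilde L_j^+(\lambda)\}$, $\lambda^j$ is the partition with $A^+(\lambda^j)=\{x\in\mathbb N:x+c_j\in S_j\}$, $L^+(\lambda^j)=\{y\in\mathbb N: c_j-y-1\notin S_j\}$, and $(\lambda^0,\ldots,\lambda^{t-1})$ is the $t$-quotient of $\lambda$. *)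

theory Defs
  imports Main
begin

text \<open>A partition is the list of its nonzero parts in weakly decreasing order, so each partition
  has exactly one representation.\<close>

definition is_partition :: "nat list \<Rightarrow> bool" where
  "is_partition p \<longleftrightarrow> sorted_wrt (\<ge>) p \<and> (\<forall>x \<in> set p. 0 < x)"

text \<open>Parts are indexed from 1, as in \<open>\<lambda>\<^sub>1 \<ge> \<lambda>\<^sub>2 \<ge> \<dots>\<close>, and are 0 beyond the length.
  The value at index 0 is junk.\<close>

definition part :: "nat list \<Rightarrow> nat \<Rightarrow> nat" where
  "part p i = (if 1 \<le> i \<and> i \<le> length p then p ! (i - 1) else 0)"

definition conj_partition :: "nat list \<Rightarrow> nat list" where
  "conj_partition p = map (\<lambda>i. card {k. 1 \<le> k \<and> i \<le> part p k}) [1..<Suc (part p 1)]"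

definition durfee :: "nat list \<Rightarrow> nat" where
  "durfee p = card {i. 1 \<le> i \<and> i \<le> part p i}"

text \<open>For partitions the subtractions below are not truncated, since both \<open>part p i\<close> and
  \<open>part (conj_partition p) i\<close> are at least \<open>i\<close> for \<open>1 \<le> i \<le> durfee p\<close>.\<close>

definition arm_set :: "nat list \<Rightarrow> nat set" where
  "arm_set p = {part p i - i | i. 1 \<le> i \<and> i \<le> durfee p}"

definition leg_set :: "nat list \<Rightarrow> nat set" where
  "leg_set p = {part (conj_partition p) i - i | i. 1 \<le> i \<and> i \<le> durfee p}"

definition frobenius_symbol :: "nat list \<Rightarrow> nat set \<times> nat set" where
  "frobenius_symbol p = (leg_set p, arm_set p)"

definition arm_component :: "nat \<Rightarrow> nat \<Rightarrow> nat list \<Rightarrow> nat set" where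
  "arm_component t j p = {q. q * t + j \<in> arm_set p}"

definition leg_component :: "nat \<Rightarrow> nat \<Rightarrow> nat list \<Rightarrow> nat set" where
  "leg_component t j p = {q. q * t + t - j - 1 \<in> leg_set p}"

definition char_entry :: "nat \<Rightarrow> nat \<Rightarrow> nat list \<Rightarrow> int" where
  "char_entry t j p = int (card (arm_component t j p)) - int (card (leg_component t j p))"

definition char_vector :: "nat \<Rightarrow> nat list \<Rightarrow> int list" where
  "char_vector t p = map (\<lambda>j. char_entry t j p) [0..<t]"

text \<open>The set \<open>S\<^sub>j\<close>.\<close>

definition state_set :: "nat \<Rightarrow> nat \<Rightarrow> nat list \<Rightarrow> int set" where
  "state_set t j p =
     int ` arm_component t j p \<union> {- int q - 1 | q. q \<notin> leg_component t j p}"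

definition quotient_component :: "nat \<Rightarrow> nat \<Rightarrow> nat list \<Rightarrow> nat list" where
  "quotient_component t j p =
     (THE m. is_partition m \<and>
        arm_set m = {x. int x + char_entry t j p \<in> state_set t j p} \<and>
        leg_set m = {y. char_entry t j p - int y - 1 \<notin> state_set t j p})"

definition t_quotient :: "nat \<Rightarrow> nat list \<Rightarrow> nat list list" where
  "t_quotient t p = map (\<lambda>j. quotient_component t j p) [0..<t]"

text \<open>The sets \<open>L\<^sub>j\<close> and \<open>A\<^sub>j\<close> built from an integer \<open>c\<close> and a partition \<open>m\<close>. Cases (i) and (ii)
  overlap at \<open>c = 0\<close>, where they agree; see \<open>built_legs_nonpos\<close> and \<open>built_arms_nonpos\<close>.\<close>

definition built_legs :: "nat \<Rightarrow> nat \<Rightarrow> int \<Rightarrow> nat list \<Rightarrow> nat set" where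
  "built_legs t j c m =
     (if c \<ge> 0
      then {(l - nat c) * t + t - j - 1 | l. l \<in> leg_set m \<and> nat c \<le> l}
      else {(l + nat \<bar>c\<bar>) * t + t - j - 1 | l. l \<in> leg_set m} \<union>
           {(nat \<bar>c\<bar> - l - 1) * t + t - j - 1 | l. l \<notin> arm_set m \<and> l < nat \<bar>c\<bar>})"

definition built_arms :: "nat \<Rightarrow> nat \<Rightarrow> int \<Rightarrow> nat list \<Rightarrow> nat set" where
  "built_arms t j c m =
     (if c \<ge> 0
      then {(a + nat c) * t + j | a. a \<in> arm_set m} \<union>
           {(nat c - a - 1) * t + j | a. a \<notin> leg_set m \<and> a < nat c}
      else {(a - nat \<bar>c\<bar>) * t + j | a. a \<in> arm_set m \<and> nat \<bar>c\<bar> \<le> a})"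

lemma built_legs_nonpos:
  "c \<le> 0 \<Longrightarrow> built_legs t j c m =
     {(l + nat \<bar>c\<bar>) * t + t - j - 1 | l. l \<in> leg_set m} \<union>
     {(nat \<bar>c\<bar> - l - 1) * t + t - j - 1 | l. l \<notin> arm_set m \<and> l < nat \<bar>c\<bar>}"
  by (cases "c = 0") (auto simp: built_legs_def)

lemma built_arms_nonpos:
  "c \<le> 0 \<Longrightarrow> built_arms t j c m =
     {(a - nat \<bar>c\<bar>) * t + j | a. a \<in> arm_set m \<and> nat \<bar>c\<bar> \<le> a}"
  by (cases "c = 0") (auto simp: built_arms_def)

end

theory Submission
  imports Defs
begin

text \<open>A partition \<open>\<lambda>\<close> is encoded by its beta set \<open>B = {\<lambda>\<^sub>i - i | i \<ge> 1}\<close>: the arms are the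
  nonnegative elements of \<open>B\<close>, and \<open>y\<close> is a leg exactly when \<open>-y-1\<close> is a hole of \<open>B\<close>. For all
  large \<open>n\<close> the set \<open>B\<close> contains everything below \<open>-n\<close> and has exactly \<open>n\<close> elements above, so
  shifting \<open>B\<close> by \<open>c\<close> gives a set whose nonnegative elements exceed its negative holes by \<open>c\<close> in
  number. The sets \<open>A\<^sub>j\<close> and \<open>L\<^sub>j\<close> place the nonnegative elements and holes of the shifted beta
  set of \<open>\<lambda>\<^sup>j\<close> in the residue class of \<open>j\<close>. As the \<open>c\<^sub>j\<close> sum to 0, the unions are the arms and
  legs of a partition, and splitting it by residues returns the shifted beta sets.\<close>

section \<open>Beta sets and Frobenius symbols\<close>

text \<open>The index is not bounded by the length: the zero parts contribute \<open>-i\<close> for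
  every \<open>i > length p\<close>, so the set is infinite downwards.\<close>

definition beta_set :: "nat list \<Rightarrow> int set" where
  "beta_set p = {int (part p i) - int i | i. 1 \<le> i}"

lemma part_antimono:
  assumes "is_partition p" "1 \<le> i" "i \<le> k"
  shows "part p k \<le> part p i"
proof (cases "k \<le> length p \<and> i < k")
  case True
  then have "p ! (k - 1) \<le> p ! (i - 1)"
    using assms by (intro sorted_wrt_nth_less[of "(\<ge>)" p, simplified]) (auto simp: is_partition_def)
  then show ?thesis using True assms by (auto simp: part_def)
qed (use assms in \<open>auto simp: part_def\<close>)

lemma part_pos_iff:
  assumes "is_partition p" "1 \<le> i"
  shows "0 < part p i \<longleftrightarrow> i \<le> length p"
  using assms by (auto simp: part_def is_partition_def)

lemma partition_eqI:
  assumes "is_partition p" "is_partition q" "\<And>i. 1 \<le> i \<Longrightarrow> part p i = part q i"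
  shows "p = q"
proof -
  have "i \<le> length p \<longleftrightarrow> i \<le> length q" if "1 \<le> i" for i
    using that assms part_pos_iff by metis
  then have len: "length p = length q"
    by (metis One_nat_def Suc_leI le_antisym le_zero_eq linorder_not_less nat_le_linear)
  show ?thesis
  proof (rule nth_equalityI[OF len])
    fix i assume "i < length p"
    then show "p ! i = q ! i" using assms(3)[of "Suc i"] len by (simp add: part_def)
  qed
qed

lemma beta_strict_decreasing:
  assumes "is_partition p" "1 \<le> i" "i < k"
  shows "int (part p k) - int k < int (part p i) - int i"
  using part_antimono[of p i k] assms by simp

section \<open>Durfee number and conjugate partition\<close>

text \<open>Turns the cardinalities in \<open>durfee\<close> and \<open>conj_partition\<close> into
  membership: once the counted index set is an initial segment, \<open>k\<close> is at most its size
  iff \<open>k\<close> lies in it.\<close>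

lemma initial_segment_eq_atLeastAtMost_card:
  fixes S :: "nat set"
  assumes "finite S" "0 \<notin> S" "\<And>i k. 1 \<le> i \<Longrightarrow> i \<le> k \<Longrightarrow> k \<in> S \<Longrightarrow> i \<in> S"
  shows "S = {1..card S}"
proof (cases "S = {}")
  case False
  then have "S = {1..Max S}"
    using assms by (auto simp: Suc_le_eq intro!: gr0I)
      (metis False Max_in)
  then show ?thesis by (metis card_atLeastAtMost diff_Suc_1)
qed simp

lemma le_card_part_iff:
  assumes "is_partition p" "1 \<le> j" "1 \<le> k"
  shows "k \<le> card {k. 1 \<le> k \<and> j \<le> part p k} \<longleftrightarrow> j \<le> part p k"
proof -
  let ?S = "{k. 1 \<le> k \<and> j \<le> part p k}"
  have "?S \<subseteq> {..length p}" using assms by (auto simp: part_def split: if_splits)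
  then have "?S = {1..card ?S}"
    using assms part_antimono[OF assms(1)]
    by (intro initial_segment_eq_atLeastAtMost_card)
      (auto intro: finite_subset le_trans)
  then have "k \<in> ?S \<longleftrightarrow> k \<in> {1..card ?S}" by simp
  then show ?thesis using assms by auto
qed

lemma le_durfee_iff:
  assumes "is_partition p" "1 \<le> i"
  shows "i \<le> durfee p \<longleftrightarrow> i \<le> part p i"
proof -
  let ?S = "{i. 1 \<le> i \<and> i \<le> part p i}"
  have "?S \<subseteq> {..length p}" by (auto simp: part_def split: if_splits)
  then have "?S = {1..card ?S}"
    using part_antimono[OF assms(1)]
    by (intro initial_segment_eq_atLeastAtMost_card)
      (auto intro: finite_subset le_trans)
  then have "i \<in> ?S \<longleftrightarrow> i \<in> {1..card ?S}" by simp
  then show ?thesis using assms by (auto simp: durfee_def)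
qed

text \<open>The list stops at \<open>part p 1\<close>; beyond that the default value 0 of
  \<open>part\<close> is still the right count, because no part reaches \<open>j\<close>.\<close>

lemma part_conj_partition:
  assumes "is_partition p" "1 \<le> j"
  shows "part (conj_partition p) j = card {k. 1 \<le> k \<and> j \<le> part p k}"
proof -
  have len: "length (conj_partition p) = part p 1" by (simp add: conj_partition_def)
  show ?thesis
  proof (cases "j \<le> part p 1")
    case False
    then have "{k. 1 \<le> k \<and> j \<le> part p k} = {}"
      using part_antimono[OF assms(1), of 1] by fastforce
    then have "card {k. 1 \<le> k \<and> j \<le> part p k} = 0" by (simp only: card.empty)
    moreover have "part (conj_partition p) j = 0"
      using False len by (simp add: part_def[of "conj_partition p"])
    ultimately show ?thesis by simp
  next
    case True
    then have "part (conj_partition p) j = conj_partition p ! (j - 1)"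
      using assms(2) len by (simp add: part_def[of "conj_partition p"])
    then show ?thesis
      using True assms(2) by (simp add: conj_partition_def del: upt_Suc)
  qed
qed

text \<open>Reflection of the Young diagram in its diagonal. All later reasoning about legs goes
  through this equivalence.\<close>

lemma le_part_conj_partition_iff:
  assumes "is_partition p" "1 \<le> j" "1 \<le> k"
  shows "k \<le> part (conj_partition p) j \<longleftrightarrow> j \<le> part p k"
  using le_card_part_iff[OF assms] part_conj_partition[OF assms(1,2)] by simp

section \<open>Arms and legs read off from the beta set\<close>

text \<open>The entry at \<open>i\<close> is nonnegative exactly for
  \<open>i \<le> durfee p\<close>, where the natural-number subtraction in \<open>arm_set\<close> is
  not truncated.\<close>

lemma mem_arm_set_iff:
  assumes "is_partition p"
  shows "x \<in> arm_set p \<longleftrightarrow> int x \<in> beta_set p"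
proof
  assume "x \<in> arm_set p"
  then obtain i where i: "1 \<le> i" "i \<le> durfee p" "x = part p i - i" by (auto simp: arm_set_def)
  then have "int x = int (part p i) - int i" using le_durfee_iff[OF assms] by auto
  then show "int x \<in> beta_set p" using i(1) by (auto simp: beta_set_def)
next
  assume "int x \<in> beta_set p"
  then obtain i where i: "1 \<le> i" "int x = int (part p i) - int i" by (auto simp: beta_set_def)
  then have "i \<le> durfee p" "x = part p i - i" using le_durfee_iff[OF assms] by auto
  then show "x \<in> arm_set p" using i(1) by (auto simp: arm_set_def)
qed

lemma mem_leg_set_iff:
  assumes p: "is_partition p"
  shows "y \<in> leg_set p \<longleftrightarrow> - int y - 1 \<notin> beta_set p"
proof
  let ?N = "\<lambda>j. part (conj_partition p) j"
  assume "y \<in> leg_set p"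
  then obtain j where j: "1 \<le> j" "j \<le> durfee p" and y: "y = ?N j - j"
    by (auto simp: leg_set_def)
  have "j \<le> ?N j"
    using le_part_conj_partition_iff[OF p, of j j] le_durfee_iff[OF p, of j] j by simp
  then have y': "- int y - 1 = int j - 1 - int (?N j)" using y by simp
  show "- int y - 1 \<notin> beta_set p"
  proof
    assume "- int y - 1 \<in> beta_set p"
    \<comment> \<open>Entries with \<open>i \<le> ?N j\<close> are at least \<open>j - ?N j\<close>,
      and later ones are at most \<open>j - ?N j - 2\<close>, so the value in between is
      skipped.\<close>
    then obtain i where i: "1 \<le> i" "int j - 1 - int (?N j) = int (part p i) - int i"
      using y' by (auto simp: beta_set_def)
    then show False
      using le_part_conj_partition_iff[OF p j(1) i(1)] by (cases "i \<le> ?N j") auto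
  qed
next
  let ?N = "\<lambda>j. part (conj_partition p) j"
  assume hole: "- int y - 1 \<notin> beta_set p"
  \<comment> \<open>The hole lies between the entries of index \<open>i\<close> and \<open>i + 1\<close> of the beta sequence; it is
    then the leg of the diagonal cell \<open>i - y\<close>.\<close>
  define P where "P = (\<lambda>k. 1 \<le> k \<and> part p k + y < k)"
  have ex: "P (length p + y + 1)" by (auto simp: P_def part_def)
  define k where "k = (LEAST k. P k)"
  have k: "1 \<le> k" "part p k + y < k" using LeastI[of P, OF ex] by (auto simp: P_def k_def)
  \<comment> \<open>\<open>k\<close> is the first index whose entry is at most \<open>-y-1\<close>.
    Equality is excluded by the hole, so the entry drops strictly below it, while minimality keeps
    the previous entry above it.\<close>
  have "int (part p k) - int k \<in> beta_set p" using k(1) by (auto simp: beta_set_def)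
  then have "int (part p k) - int k \<noteq> - int y - 1" using hole by metis
  then have k2: "part p k + y + 1 < k" using k by linarith
  define i where "i = k - 1"
  have i: "1 \<le> i" "k = i + 1" using k2 by (auto simp: i_def)
  have "\<not> P i" using not_less_Least[of i P] i by (simp add: k_def[symmetric])
  then have i2: "i \<le> part p i + y" using i by (auto simp: P_def)
  define j where "j = i - y"
  have j: "1 \<le> j" "part p (i + 1) < j" "j \<le> part p i" using i i2 k2 by (auto simp: j_def)
  have "i \<le> ?N j" "\<not> i + 1 \<le> ?N j"
    using le_part_conj_partition_iff[OF p j(1)] i(1) j by auto
  then have N: "?N j = i" by simp
  then have "j \<le> part p j"
    using le_part_conj_partition_iff[OF p j(1) j(1)] by (simp add: j_def)
  then have "j \<le> durfee p" using le_durfee_iff[OF p j(1)] by simp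
  moreover have "y = ?N j - j" using N j(1) by (simp add: j_def)
  ultimately show "y \<in> leg_set p" using j(1) by (auto simp: leg_set_def)
qed

section \<open>Uniqueness of the partition with a given Frobenius symbol\<close>

lemma beta_set_eqI:
  assumes "is_partition p" "is_partition q" "arm_set p = arm_set q" "leg_set p = leg_set q"
  shows "beta_set p = beta_set q"
proof (rule set_eqI)
  fix x :: int
  show "x \<in> beta_set p \<longleftrightarrow> x \<in> beta_set q"
  proof (cases "0 \<le> x")
    case True
    then show ?thesis
      using mem_arm_set_iff[OF assms(1), of "nat x"] mem_arm_set_iff[OF assms(2), of "nat x"] assms
      by simp
  next
    case False
    then show ?thesis
      using mem_leg_set_iff[OF assms(1), of "nat (- x - 1)"]
        mem_leg_set_iff[OF assms(2), of "nat (- x - 1)"] assms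
      by simp
  qed
qed

text \<open>A strictly decreasing sequence is determined by its range; the entries are compared by
  strong induction on the index.\<close>

lemma beta_set_inject:
  assumes p: "is_partition p" and q: "is_partition q" and eq: "beta_set p = beta_set q"
  shows "p = q"
proof (rule partition_eqI[OF p q])
  \<comment> \<open>Stated for arbitrary \<open>p\<close> and \<open>q\<close>, so that exchanging
    them yields the reverse inequality.\<close>
  have le: "part q i \<le> part p i"
    if p: "is_partition p" and q: "is_partition q" and eq: "beta_set p = beta_set q"
      and i: "1 \<le> i" and IH: "\<And>k. 1 \<le> k \<Longrightarrow> k < i \<Longrightarrow> part p k = part q k"
    for p q i
  proof -
    have "int (part q i) - int i \<in> beta_set p" using i eq by (auto simp: beta_set_def)
    then obtain k where k: "1 \<le> k" "int (part q i) - int i = int (part p k) - int k"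
      by (auto simp: beta_set_def)
    \<comment> \<open>For \<open>k < i\<close> the induction hypothesis would make this the
      \<open>k\<close>-th entry of \<open>q\<close> as well, which is strictly larger than the
      \<open>i\<close>-th.\<close>
    have "\<not> k < i" using IH[of k] k beta_strict_decreasing[OF q k(1), of i] by auto
    then show ?thesis
      using beta_strict_decreasing[OF p i, of k] k by (cases "k = i") auto
  qed
  fix i :: nat assume "1 \<le> i"
  then show "part p i = part q i"
  proof (induction i rule: less_induct)
    case (less i)
    have IH: "part p k = part q k" if "1 \<le> k" "k < i" for k
      using less.IH[OF that(2,1)] .
    show ?case
      using le[OF p q eq less.prems] le[OF q p eq[symmetric] less.prems] IH
      by (simp add: le_antisym)
  qed
qed

lemma frobenius_symbol_inject:
  assumes "is_partition p" "is_partition q" "arm_set p = arm_set q" "leg_set p = leg_set q"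
  shows "p = q"
  using beta_set_inject[OF assms(1,2)] beta_set_eqI[OF assms] by blast

section \<open>Existence of a partition with a given Frobenius symbol\<close>

text \<open>The diagram of \<open>p\<close> is moved one step down the diagonal and enclosed in a
  hook with arm \<open>a\<close> and leg \<open>l\<close>. This is the intended shape when
  \<open>part p 1 \<le> a\<close> and \<open>length p \<le> l\<close>.\<close>

definition add_hook :: "nat \<Rightarrow> nat \<Rightarrow> nat list \<Rightarrow> nat list" where
  "add_hook a l p = Suc a # map Suc p @ replicate (l - length p) 1"

lemma is_partition_add_hook:
  assumes "is_partition p" "part p 1 \<le> a"
  shows "is_partition (add_hook a l p)"
proof -
  have "x \<le> a" if x: "x \<in> set p" for x
  proof -
    obtain i where "i < length p" "p ! i = x" using x by (auto simp: in_set_conv_nth)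
    then have "part p (Suc i) = x" by (simp add: part_def)
    then show ?thesis
      using part_antimono[OF assms(1), of 1 "Suc i"] assms(2) by linarith
  qed
  then show ?thesis
    using assms(1)
    by (auto simp: is_partition_def add_hook_def sorted_wrt_append sorted_wrt_map
        sorted_wrt_iff_nth_less[of _ "replicate _ _"])
qed

lemma part_add_hook:
  assumes "length p \<le> l"
  shows "part (add_hook a l p) (Suc 0) = Suc a"
    and "1 \<le> i \<Longrightarrow> part (add_hook a l p) (Suc i) = (if i \<le> l then Suc (part p i) else 0)"
  using assms by (auto simp: part_def add_hook_def nth_append nth_Cons')

text \<open>The new first row contributes \<open>a\<close>. Rows \<open>2\<close> to
  \<open>l + 1\<close> repeat the old entries, as part and index both grow by one. The old entry
  \<open>-l-1\<close>, coming from a zero part, loses its place, and the entries below it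
  stay.\<close>

lemma beta_set_add_hook:
  assumes len: "length p \<le> l"
  shows "beta_set (add_hook a l p) = insert (int a) (beta_set p) - {- int l - 1}"
proof -
  have tail: "- int k \<in> beta_set p" if "l < k" for k
    using that len by (auto simp: beta_set_def part_def intro!: exI[of _ k])
  have "beta_set (add_hook a l p) =
      insert (int a) ({int (part p i) - int i | i. 1 \<le> i \<and> i \<le> l} \<union> {- int i | i. l + 1 < i})"
    (is "?L = ?R")
  proof
    show "?L \<subseteq> ?R"
    proof
      fix x assume "x \<in> ?L"
      then obtain i where i: "1 \<le> i" "x = int (part (add_hook a l p) i) - int i"
        by (auto simp: beta_set_def)
      obtain k where k: "i = Suc k" using i(1) by (cases i) auto
      consider "k = 0" | "1 \<le> k" "k \<le> l" | "l < k" by linarith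
      then show "x \<in> ?R"
      proof cases
        case 3
        then have "x = - int i" "l + 1 < i" using i k part_add_hook(2)[OF len, of k a] by auto
        then show ?thesis by blast
      qed (use i k part_add_hook[OF len] in auto)
    qed
    show "?R \<subseteq> ?L"
    proof
      fix x assume "x \<in> ?R"
      then consider "x = int a" | i where "1 \<le> i" "i \<le> l" "x = int (part p i) - int i"
        | i where "l + 1 < i" "x = - int i" by blast
      then show "x \<in> ?L"
      proof cases
        case 1
        then show ?thesis using part_add_hook(1)[OF len]
          by (auto simp: beta_set_def intro!: exI[of _ "Suc 0"])
      next
        case (2 i)
        then show ?thesis using part_add_hook(2)[OF len]
          by (auto simp: beta_set_def intro!: exI[of _ "Suc i"])
      next
        case (3 i)
        then show ?thesis using part_add_hook(2)[OF len, of "i - 1" a]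
          by (auto simp: beta_set_def intro!: exI[of _ i])
      qed
    qed
  qed
  also have "\<dots> = insert (int a) (beta_set p) - {- int l - 1}" (is "_ = ?R'")
  proof
    show "?R \<subseteq> ?R'"
      using tail by (auto simp: beta_set_def)
    show "?R' \<subseteq> ?R"
    proof
      fix x assume x: "x \<in> ?R'"
      show "x \<in> ?R"
      proof (cases "x = int a")
        case False
        then obtain i where i: "1 \<le> i" "x = int (part p i) - int i"
          using x by (auto simp: beta_set_def)
        show ?thesis
        proof (cases "i \<le> l")
          case False
          then have "x = - int i" using i len by (simp add: part_def)
          moreover have "i \<noteq> l + 1" using x calculation by auto
          ultimately have "x = - int i" "l + 1 < i" using False by auto
          then show ?thesis by blast
        qed (use i in auto)
      qed simp
    qed
  qed
  finally show ?thesis .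
qed

text \<open>If the first part is positive, then \<open>part p 1 - 1\<close> is itself an
  arm.\<close>

lemma part_1_le_if_arms_less:
  assumes "is_partition p" "\<And>x. x \<in> arm_set p \<Longrightarrow> x < a"
  shows "part p 1 \<le> a"
proof (cases "part p 1")
  case (Suc b)
  then have "int b \<in> beta_set p" by (auto simp: beta_set_def intro!: exI[of _ 1])
  then show ?thesis using assms mem_arm_set_iff Suc by fastforce
qed simp

text \<open>For nonempty \<open>p\<close>, \<open>length p - 1\<close> is a leg: positive parts have
  entries above \<open>-length p\<close>, zero parts have entries below it.\<close>

lemma length_le_if_legs_less:
  assumes p: "is_partition p" and less: "\<And>y. y \<in> leg_set p \<Longrightarrow> y < l"
  shows "length p \<le> l"
proof (cases "length p")
  case (Suc n)
  have "- int n - 1 \<notin> beta_set p"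
  proof
    assume "- int n - 1 \<in> beta_set p"
    then obtain i where "1 \<le> i" "- int n - 1 = int (part p i) - int i"
      by (auto simp: beta_set_def)
    then show False using part_pos_iff[OF p, of i] Suc by (cases "i \<le> length p") auto
  qed
  then show ?thesis using mem_leg_set_iff[OF p] less Suc by fastforce
qed simp

text \<open>Induction removes the largest arm and the largest leg and puts them back as an outer
  hook. Their maximality bounds the first part and the length of the smaller partition, so the hook
  fits around it.\<close>

lemma frobenius_symbol_exists:
  assumes "finite A" "finite L" "card A = card L"
  shows "\<exists>p. is_partition p \<and> arm_set p = A \<and> leg_set p = L"
  using assms
proof (induction "card A" arbitrary: A L)
  case 0
  then have "A = {}" "L = {}" by auto
  moreover have "is_partition []" "durfee [] = 0"
    by (simp_all add: is_partition_def durfee_def part_def)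
  ultimately show ?case by (intro exI[of _ "[]"]) (auto simp: arm_set_def leg_set_def)
next
  case (Suc n)
  define a l where "a = Max A" and "l = Max L"
  have ne: "A \<noteq> {}" "L \<noteq> {}" using Suc by auto
  have mem: "a \<in> A" "l \<in> L" using Suc ne by (auto simp: a_def l_def)
  have "n = card (A - {a})" "card (A - {a}) = card (L - {l})"
    using Suc mem by simp_all
  with Suc.hyps(1)[of "A - {a}" "L - {l}"] Suc.prems
  obtain p where p: "is_partition p" "arm_set p = A - {a}" "leg_set p = L - {l}" by auto
  have "x < a" if "x \<in> A - {a}" for x
    using that Suc.prems Max_ge[of A x] by (auto simp: a_def less_le)
  then have part: "part p 1 \<le> a" using part_1_le_if_arms_less[OF p(1)] p by auto
  have "y < l" if "y \<in> L - {l}" for y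
    using that Suc.prems Max_ge[of L y] by (auto simp: l_def less_le)
  then have len: "length p \<le> l" using length_le_if_legs_less[OF p(1)] p by auto
  have q: "is_partition (add_hook a l p)" using is_partition_add_hook p(1) part .
  have "x \<in> arm_set (add_hook a l p) \<longleftrightarrow> x \<in> A" for x
    using mem_arm_set_iff[OF q] mem_arm_set_iff[OF p(1), of x] beta_set_add_hook[OF len] p(2) mem
    by auto
  moreover have "y \<in> leg_set (add_hook a l p) \<longleftrightarrow> y \<in> L" for y
    using mem_leg_set_iff[OF q] mem_leg_set_iff[OF p(1), of y] beta_set_add_hook[OF len] p(3) mem
    by auto
  ultimately show ?case using q by blast
qed

section \<open>Charge\<close>

lemma beta_set_contains_below:
  assumes "x < - int (length p)"
  shows "x \<in> beta_set p"
  using assms by (auto simp: beta_set_def part_def intro!: exI[of _ "nat (- x)"])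

text \<open>Since \<open>n\<close> is at least the length, the entries that are at least
  \<open>-n\<close> are those of index \<open>1\<close> to \<open>n\<close>, and they are
  distinct.\<close>

lemma beta_set_window:
  assumes p: "is_partition p" and n: "length p \<le> n"
  shows "finite (beta_set p \<inter> {- int n..})" "card (beta_set p \<inter> {- int n..}) = n"
proof -
  let ?b = "\<lambda>i. int (part p i) - int i"
  have "beta_set p = ?b ` {1..}" by (auto simp: beta_set_def)
  moreover have "- int n \<le> ?b i \<longleftrightarrow> i \<le> n" for i
    using n by (cases "i \<le> n") (auto simp: part_def)
  ultimately have "beta_set p \<inter> {- int n..} = ?b ` {1..n}" by auto
  moreover have "inj_on ?b {1..n}"
  proof (rule inj_onI)
    fix i k assume "i \<in> {1..n}" "k \<in> {1..n}" "?b i = ?b k"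
    then show "i = k"
      using beta_strict_decreasing[OF p, of i k] beta_strict_decreasing[OF p, of k i]
      by (cases i k rule: linorder_cases) auto
  qed
  ultimately show "finite (beta_set p \<inter> {- int n..})" "card (beta_set p \<inter> {- int n..}) = n"
    by (simp_all add: card_image)
qed

text \<open>Of the \<open>n\<close> places from \<open>-n\<close> to \<open>-1\<close>, all but the
  holes are occupied, and every hole lies there. The window count is easy to follow under
  translation, unlike the two separate cardinalities.\<close>

lemma charge_eq_window:
  fixes S :: "int set"
  assumes below: "\<And>x. x < - int n \<Longrightarrow> x \<in> S" and fin: "finite (S \<inter> {- int n..})"
  shows "finite {x. int x \<in> S}" "finite {y. - int y - 1 \<notin> S}"
    and "int (card {x. int x \<in> S}) - int (card {y. - int y - 1 \<notin> S}) =
      int (card (S \<inter> {- int n..})) - int n"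
proof -
  let ?X = "{x. int x \<in> S}" and ?Y = "{y. - int y - 1 \<notin> S}" and ?g = "\<lambda>y. - int y - 1"
  have inj: "inj_on ?g M" for M by (auto intro: inj_onI)
  have "int ` ?X \<subseteq> S \<inter> {- int n..}" by auto
  then show finX: "finite ?X" using fin by (meson finite_imageD finite_subset inj_on_of_nat)
  have Y: "?Y \<subseteq> {..<n}"
  proof
    fix y assume "y \<in> ?Y"
    then show "y \<in> {..<n}" using below[of "- int y - 1"] by (cases "y < n") auto
  qed
  then show finY: "finite ?Y" by (rule finite_subset) simp
  have split: "S \<inter> {- int n..} = int ` ?X \<union> ?g ` ({..<n} - ?Y)"
  proof
    show "S \<inter> {- int n..} \<subseteq> int ` ?X \<union> ?g ` ({..<n} - ?Y)"
    proof
      fix x assume x: "x \<in> S \<inter> {- int n..}"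
      show "x \<in> int ` ?X \<union> ?g ` ({..<n} - ?Y)"
      proof (cases "0 \<le> x")
        case True
        then show ?thesis using x by (auto intro!: image_eqI[of _ _ "nat x"])
      next
        case False
        then show ?thesis using x by (auto intro!: image_eqI[of _ _ "nat (- x - 1)"])
      qed
    qed
  qed auto
  have "card (S \<inter> {- int n..}) = card (int ` ?X) + card (?g ` ({..<n} - ?Y))"
    unfolding split using finX by (intro card_Un_disjoint) auto
  also have "\<dots> = card ?X + (n - card ?Y)"
    using Y finY by (simp add: card_image inj card_Diff_subset)
  finally show "int (card ?X) - int (card ?Y) = int (card (S \<inter> {- int n..})) - int n"
    using card_mono[OF _ Y] by simp
qed

lemma shifted_beta_set_charge:
  fixes c :: int
  assumes p: "is_partition p"
  defines "S \<equiv> {x. x - c \<in> beta_set p}"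
  shows "finite {x. int x \<in> S}" "finite {y. - int y - 1 \<notin> S}"
    and "int (card {x. int x \<in> S}) - int (card {y. - int y - 1 \<notin> S}) = c"
proof -
  \<comment> \<open>The margin \<open>\<bar>c\<bar>\<close> keeps \<open>n + c\<close> at or above
    \<open>length p\<close>, so \<open>nat\<close> does not truncate and translation by
    \<open>c\<close> carries the window at \<open>-k\<close> to the window at
    \<open>-n\<close>.\<close>
  define n k where "n = length p + nat \<bar>c\<bar>" and "k = nat (int n + c)"
  have k: "int k = int n + c" "length p \<le> k" by (auto simp: n_def k_def)
  have below: "x \<in> S" if "x < - int n" for x
    using that k beta_set_contains_below[of "x - c" p] by (simp add: S_def)
  have window: "S \<inter> {- int n..} = (\<lambda>x. x + c) ` (beta_set p \<inter> {- int k..})"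
    using k(1) by (auto simp: S_def intro!: image_eqI[of _ _ "_ - c"])
  have fin: "finite (S \<inter> {- int n..})"
    unfolding window using beta_set_window(1)[OF p k(2)] by simp
  have card: "card (S \<inter> {- int n..}) = k"
    unfolding window using beta_set_window(2)[OF p k(2)] by (simp add: card_image)
  show "finite {x. int x \<in> S}" "finite {y. - int y - 1 \<notin> S}"
    and "int (card {x. int x \<in> S}) - int (card {y. - int y - 1 \<notin> S}) = c"
    using charge_eq_window[of n S, OF below fin] card k(1) by auto
qed

section \<open>Residue classes\<close>

text \<open>Both cases of the definition describe one shift. For \<open>c \<ge> 0\<close> all arms
  survive and the negative elements from \<open>-c\<close> to \<open>-1\<close> become nonnegative;
  for \<open>c < 0\<close> only the arms that are at least \<open>\<bar>c\<bar>\<close> remain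
  nonnegative.\<close>

lemma built_arms_eq_image:
  assumes m: "is_partition m"
  shows "built_arms t j c m = (\<lambda>q. q * t + j) ` {x. int x - c \<in> beta_set m}"
proof (cases "0 \<le> c")
  case True
  have "{x. int x - c \<in> beta_set m} =
      {a + nat c | a. a \<in> arm_set m} \<union> {nat c - a - 1 | a. a \<notin> leg_set m \<and> a < nat c}"
    (is "?X = ?Y")
  proof
    show "?X \<subseteq> ?Y"
    proof
      fix x assume x: "x \<in> ?X"
      show "x \<in> ?Y"
      proof (cases "nat c \<le> x")
        case le: True
        then have "x - nat c \<in> arm_set m" "x = (x - nat c) + nat c"
          using x True mem_arm_set_iff[OF m, of "x - nat c"] by auto
        then show ?thesis by blast
      next
        case False
        then have "- int (nat c - x - 1) - 1 = int x - c" using True by linarith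
        then have "nat c - x - 1 \<notin> leg_set m" "x = nat c - (nat c - x - 1) - 1" "nat c - x - 1 < nat c"
          using x False mem_leg_set_iff[OF m, of "nat c - x - 1"] by auto
        then show ?thesis by blast
      qed
    qed
    show "?Y \<subseteq> ?X"
    proof
      fix x assume "x \<in> ?Y"
      then consider a where "x = a + nat c" "a \<in> arm_set m"
        | a where "x = nat c - a - 1" "a \<notin> leg_set m" "a < nat c" by blast
      then show "x \<in> ?X"
      proof cases
        case (1 a)
        then have "int x - c = int a" using True by linarith
        then show ?thesis using 1 mem_arm_set_iff[OF m] by simp
      next
        case (2 a)
        then have "int x - c = - int a - 1" by linarith
        then show ?thesis using 2 mem_leg_set_iff[OF m, of a] by (metis mem_Collect_eq)
      qed
    qed
  qed
  then show ?thesis using True by (auto simp: built_arms_def)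
next
  case False
  have "{x. int x - c \<in> beta_set m} = {a - nat \<bar>c\<bar> | a. a \<in> arm_set m \<and> nat \<bar>c\<bar> \<le> a}"
    (is "?X = ?Y")
  proof
    show "?X \<subseteq> ?Y"
    proof
      fix x assume "x \<in> ?X"
      then have "x + nat \<bar>c\<bar> \<in> arm_set m" using False mem_arm_set_iff[OF m] by simp
      then show "x \<in> ?Y" by force
    qed
    show "?Y \<subseteq> ?X" using False mem_arm_set_iff[OF m] by auto
  qed
  then show ?thesis using False by (auto simp: built_arms_def)
qed

text \<open>The mirror image for holes: when \<open>c < 0\<close>, the gaps among \<open>0\<close>
  to \<open>\<bar>c\<bar> - 1\<close> move below zero and become new holes.\<close>

lemma built_legs_eq_image:
  assumes m: "is_partition m"
  shows "built_legs t j c m = (\<lambda>q. q * t + t - j - 1) ` {y. - int y - 1 - c \<notin> beta_set m}"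
proof (cases "0 \<le> c")
  case True
  have "{y. - int y - 1 - c \<notin> beta_set m} = {l - nat c | l. l \<in> leg_set m \<and> nat c \<le> l}"
    (is "?X = ?Y")
  proof
    show "?X \<subseteq> ?Y"
    proof
      fix x assume "x \<in> ?X"
      moreover have "- int x - 1 - c = - int (x + nat c) - 1" using True by linarith
      ultimately have "x + nat c \<in> leg_set m" using mem_leg_set_iff[OF m] by simp
      then show "x \<in> ?Y" by force
    qed
    show "?Y \<subseteq> ?X"
    proof
      fix x assume "x \<in> ?Y"
      then obtain l where l: "x = l - nat c" "l \<in> leg_set m" "nat c \<le> l" by blast
      then have "- int x - 1 - c = - int l - 1" using True by linarith
      then show "x \<in> ?X" using l mem_leg_set_iff[OF m] by simp
    qed
  qed
  then show ?thesis using True by (auto simp: built_legs_def)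
next
  case False
  let ?d = "nat \<bar>c\<bar>"
  have "{y. - int y - 1 - c \<notin> beta_set m} =
      {l + ?d | l. l \<in> leg_set m} \<union> {?d - l - 1 | l. l \<notin> arm_set m \<and> l < ?d}"
    (is "?X = ?Y")
  proof
    show "?X \<subseteq> ?Y"
    proof
      fix x assume x: "x \<in> ?X"
      show "x \<in> ?Y"
      proof (cases "?d \<le> x")
        case le: True
        then have "- int (x - ?d) - 1 = - int x - 1 - c" using False by linarith
        then have "x - ?d \<in> leg_set m"
          using x mem_leg_set_iff[OF m, of "x - ?d"] by (metis mem_Collect_eq)
        moreover have "x = (x - ?d) + ?d" using le by simp
        ultimately show ?thesis by blast
      next
        case gt: False
        then have "int (?d - x - 1) = - int x - 1 - c" using False by linarith
        then have "?d - x - 1 \<notin> arm_set m"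
          using x mem_arm_set_iff[OF m, of "?d - x - 1"] by (metis mem_Collect_eq)
        moreover have "x = ?d - (?d - x - 1) - 1" "?d - x - 1 < ?d" using gt by auto
        ultimately show ?thesis by blast
      qed
    qed
    show "?Y \<subseteq> ?X"
    proof
      fix x assume "x \<in> ?Y"
      then consider l where "x = l + ?d" "l \<in> leg_set m"
        | l where "x = ?d - l - 1" "l \<notin> arm_set m" "l < ?d" by blast
      then show "x \<in> ?X"
      proof cases
        case (1 l)
        then have "- int x - 1 - c = - int l - 1" using False by linarith
        then show ?thesis using 1 mem_leg_set_iff[OF m, of l] by (metis mem_Collect_eq)
      next
        case (2 l)
        then have "- int x - 1 - c = int l" using False by linarith
        then show ?thesis using 2 mem_arm_set_iff[OF m, of l] by (metis mem_Collect_eq)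
      qed
    qed
  qed
  then show ?thesis using False by (auto simp: built_legs_def)
qed

section \<open>Disjointness of residue classes\<close>

lemma mult_add_residue_eq_iff:
  fixes q q' t j j' :: nat
  assumes "j < t" "j' < t"
  shows "q * t + j = q' * t + j' \<longleftrightarrow> q = q' \<and> j = j'"
proof
  assume eq: "q * t + j = q' * t + j'"
  then have "(q * t + j) div t = (q' * t + j') div t" by simp
  moreover have "(q * t + j) div t = q" "(q' * t + j') div t = q'"
    using assms by simp_all
  ultimately show "q = q' \<and> j = j'" using eq by simp
qed simp

lemma mult_add_coresidue_eq_iff:
  fixes q q' t j j' :: nat
  assumes "j < t" "j' < t"
  shows "q * t + t - j - 1 = q' * t + t - j' - 1 \<longleftrightarrow> q = q' \<and> j = j'"
  using mult_add_residue_eq_iff[of "t - j - 1" t "t - j' - 1" q q'] assms by auto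

text \<open>A general \<open>f\<close> covers both uses: residue \<open>j\<close> for arms and
  residue \<open>t - j - 1\<close> for legs.\<close>

lemma card_UN_residue_images:
  fixes f :: "nat \<Rightarrow> nat \<Rightarrow> nat"
  assumes f: "\<And>j j' q q'. j < t \<Longrightarrow> j' < t \<Longrightarrow> f j q = f j' q' \<longleftrightarrow> q = q' \<and> j = j'"
    and fin: "\<And>j. j < t \<Longrightarrow> finite (X j)"
  shows "card (\<Union>j<t. f j ` X j) = (\<Sum>j<t. card (X j))"
proof -
  have "card (\<Union>j<t. f j ` X j) = (\<Sum>j<t. card (f j ` X j))"
    using fin f by (intro card_UN_disjoint) auto
  also have "\<dots> = (\<Sum>j<t. card (X j))"
    using f by (intro sum.cong refl card_image inj_onI) auto
  finally show ?thesis .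
qed

lemma mem_UN_residue_images_iff:
  fixes f :: "nat \<Rightarrow> nat \<Rightarrow> nat"
  assumes "\<And>j j' q q'. j < t \<Longrightarrow> j' < t \<Longrightarrow> f j q = f j' q' \<longleftrightarrow> q = q' \<and> j = j'"
    and "j < t"
  shows "f j q \<in> (\<Union>j<t. f j ` X j) \<longleftrightarrow> q \<in> X j"
  using assms by auto

section \<open>Recovering the quotient\<close>

lemma int_mem_state_set_iff: "int q \<in> state_set t j p \<longleftrightarrow> q \<in> arm_component t j p"
  by (auto simp: state_set_def)

lemma neg_mem_state_set_iff: "- int q - 1 \<in> state_set t j p \<longleftrightarrow> q \<notin> leg_component t j p"
  by (auto simp: state_set_def)

text \<open>The definite description is well determined because a partition is fixed by its arms and
  legs.\<close>

lemma quotient_component_eqI: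
  assumes "is_partition m"
    and "arm_set m = {x. int x + char_entry t j p \<in> state_set t j p}"
    and "leg_set m = {y. char_entry t j p - int y - 1 \<notin> state_set t j p}"
  shows "quotient_component t j p = m"
  unfolding quotient_component_def
  by (rule the_equality) (use assms frobenius_symbol_inject in auto)

theorem theorem3p27:
  fixes t :: nat and c :: "int list" and ms :: "nat list list"
  assumes "1 \<le> t"
    and "length c = t" and "sum_list c = 0"
    and "length ms = t" and "\<forall>m \<in> set ms. is_partition m"
  shows "\<exists>p. is_partition p \<and>
           frobenius_symbol p =
             (\<Union>j<t. built_legs t j (c ! j) (ms ! j), \<Union>j<t. built_arms t j (c ! j) (ms ! j)) \<and>
           char_vector t p = c \<and>
           t_quotient t p = ms"
proof -
  have m: "is_partition (ms ! j)" if "j < t" for j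
    using assms(4,5) that by simp
  \<comment> \<open>The shifted beta sets; they reappear below as the state sets of the partition
    under construction.\<close>
  define S where "S j = {x. x - c ! j \<in> beta_set (ms ! j)}" for j
  define X where "X j = {x. int x \<in> S j}" for j
  define Y where "Y j = {y. - int y - 1 \<notin> S j}" for j
  have fin: "finite (X j)" "finite (Y j)"
    and charge: "int (card (X j)) - int (card (Y j)) = c ! j" if "j < t" for j
    using shifted_beta_set_charge[OF m[OF that], of "c ! j"] by (simp_all add: X_def Y_def S_def)
  define A where "A = (\<Union>j<t. (\<lambda>q. q * t + j) ` X j)"
  define L where "L = (\<Union>j<t. (\<lambda>q. q * t + t - j - 1) ` Y j)"
  have A: "A = (\<Union>j<t. built_arms t j (c ! j) (ms ! j))"
    using built_arms_eq_image[OF m] by (simp add: A_def X_def S_def)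
  have L: "L = (\<Union>j<t. built_legs t j (c ! j) (ms ! j))"
    using built_legs_eq_image[OF m] by (simp add: L_def Y_def S_def)
  have "card A = (\<Sum>j<t. card (X j))"
    unfolding A_def using fin by (intro card_UN_residue_images) (auto simp: mult_add_residue_eq_iff)
  moreover have "card L = (\<Sum>j<t. card (Y j))"
    unfolding L_def using fin
    by (intro card_UN_residue_images mult_add_coresidue_eq_iff) auto
  \<comment> \<open>The charges of the residue classes add up to the sum of \<open>c\<close>. Its
    vanishing gives the equal cardinalities required for a Frobenius symbol.\<close>
  ultimately have "int (card A) - int (card L) = (\<Sum>j<t. c ! j)"
    using charge by (simp add: sum_subtractf[symmetric])
  also have "\<dots> = 0" using assms(2,3) by (simp add: sum_list_sum_nth atLeast0LessThan)
  finally have "card A = card L" by simp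
  then obtain p where p: "is_partition p" "arm_set p = A" "leg_set p = L"
    using frobenius_symbol_exists[of A L] fin by (auto simp: A_def L_def)
  have arm: "arm_component t j p = X j" if "j < t" for j
    unfolding arm_component_def p(2) A_def
    using mem_UN_residue_images_iff[of t "\<lambda>j q. q * t + j", OF mult_add_residue_eq_iff that]
    by simp
  have leg: "leg_component t j p = Y j" if "j < t" for j
    unfolding leg_component_def p(3) L_def
    using mem_UN_residue_images_iff[of t "\<lambda>j q. q * t + t - j - 1",
        OF mult_add_coresidue_eq_iff that]
    by simp
  have char: "char_entry t j p = c ! j" if "j < t" for j
    using charge that by (simp add: char_entry_def arm leg)
  \<comment> \<open>Nonnegative integers are decided by the arm component, negative ones by the leg
    component.\<close>
  have state: "state_set t j p = S j" if "j < t" for j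
  proof (rule set_eqI)
    fix x :: int
    show "x \<in> state_set t j p \<longleftrightarrow> x \<in> S j"
    proof (cases "0 \<le> x")
      case True
      then obtain q where "x = int q" by (metis nonneg_int_cases)
      then show ?thesis using int_mem_state_set_iff arm[OF that] by (simp add: X_def)
    next
      case False
      then have "x = - int (nat (- x - 1)) - 1" by simp
      then show ?thesis
        using neg_mem_state_set_iff leg[OF that] unfolding Y_def by (metis mem_Collect_eq)
    qed
  qed
  \<comment> \<open>Undoing the shift by \<open>c ! j\<close> turns \<open>S j\<close> back into the
    beta set of \<open>ms ! j\<close>.\<close>
  have "quotient_component t j p = ms ! j" if "j < t" for j
  proof (rule quotient_component_eqI[OF m[OF that]])
    show "arm_set (ms ! j) = {x. int x + char_entry t j p \<in> state_set t j p}"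
      using that mem_arm_set_iff[OF m[OF that]] by (auto simp: char state S_def)
    have "c ! j - int y - 1 - c ! j = - int y - 1" for y by simp
    then show "leg_set (ms ! j) = {y. char_entry t j p - int y - 1 \<notin> state_set t j p}"
      unfolding char[OF that] state[OF that] S_def using mem_leg_set_iff[OF m[OF that]] by auto
  qed
  then have "t_quotient t p = ms"
    using assms(4) by (intro nth_equalityI) (auto simp: t_quotient_def)
  moreover have "char_vector t p = c"
    using assms(2) char by (intro nth_equalityI) (auto simp: char_vector_def)
  ultimately show ?thesis
    using p A L by (intro exI[of _ p]) (simp add: frobenius_symbol_def)
qed

end
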